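(* Let $\mathcal{A}$ be a full sub-Waldhausen-category of the Waldhausen category $\mathrm{SmCat}_*$ of pointed small categories satisfying the following conditions: (1) pushouts along cofibrations computed in $\mathcal{A}$ agree with the same pushouts computed in $\mathrm{SmCat}_*$; and (2) if a pointed small category $\mathcal{C}$ is contained in $\mathcal{A}$, then $\mathcal{A}$ also contains the (pointed) category which has object set $\mathrm{ob}\,\mathcal{C}$ and which has exactly one morphism $X\to Y$ for each ordered pair $X,Y$ in $\mathrm{ob}\,\mathcal{C}$. Then the only cofiber-additive Euler characteristic on $\mathcal{A}$ is identically zero.
   Context: $\mathrm{SmCat}_*$ is the category of small categories $\mathcal{X}$ equipped with a functor $1\to\mathcal{X}$ from the terminal category $1$, with base-point-preserving functors. In the pointed Joyal-Tierney model structure, cofibrations are the functors injective on objects, weak equivalences are the equivalences of categories, and fibrations are the isofibrations (on underlying functors). All objects are cofibrant, so $\mathrm{SmCat}_*$, with these cofibrations and weak equivalences and zero object $1$, is a Waldhausen category. A full sub-Waldhausen-category is a full subcategory containing the zero object which is a Waldhausen category with cofibrations and weak equivalences those of its maps that are cofibrations, respectively weak equivalences, in $\mathrm{SmCat}_*$. A cofiber-additive Euler characteristic on $\mathcal{A}$ is a function $\chi$ from the objects of $\mathcal{A}$ to an abelian group such that, whenever $\mathcal{C},\mathcal{D},\mathcal{E}$ are objects of $\mathcal{A}$ and there is a homotopy pushout square in $\mathrm{SmCat}_*$ with top row $\mathcal{C}\to\mathcal{D}$, left column $\mathcal{C}\to 1$, and remaining corner $\mathcal{E}$ (with maps $1\to\mathcal{E}$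 and $\mathcal{D}\to\mathcal{E}$), one has $\chi(\mathcal{D})=\chi(\mathcal{C})+\chi(\mathcal{E})$. *)

theory Defs
  imports Main "HOL-Library.FuncSet"
begin

section \<open>Categories, functors, equivalences\<close>

record ('o, 'a) cat =
  Ob  :: "'o set"
  Ar  :: "'a set"
  src :: "'a \<Rightarrow> 'o"
  tgt :: "'a \<Rightarrow> 'o"
  ide :: "'o \<Rightarrow> 'a"
  cmp :: "'a \<Rightarrow> 'a \<Rightarrow> 'a"  (infixr "\<cdot>\<index>" 70)

definition hom :: "('o, 'a, 'm) cat_scheme \<Rightarrow> 'o \<Rightarrow> 'o \<Rightarrow> 'a set" where
  "hom K X Y = {f \<in> Ar K. src K f = X \<and> tgt K f = Y}"

locale category =
  fixes K :: "('o, 'a, 'm) cat_scheme" (structure)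
  assumes src_Ob: "f \<in> Ar K \<Longrightarrow> src K f \<in> Ob K"
    and tgt_Ob: "f \<in> Ar K \<Longrightarrow> tgt K f \<in> Ob K"
    and ide_hom: "X \<in> Ob K \<Longrightarrow> ide K X \<in> hom K X X"
    and cmp_hom: "f \<in> hom K X Y \<Longrightarrow> g \<in> hom K Y Z \<Longrightarrow> g \<cdot> f \<in> hom K X Z"
    and cmp_ide: "f \<in> hom K X Y \<Longrightarrow> f \<cdot> ide K X = f"
    and ide_cmp: "f \<in> hom K X Y \<Longrightarrow> ide K Y \<cdot> f = f"
    and cmp_assoc: "f \<in> hom K W X \<Longrightarrow> g \<in> hom K X Y \<Longrightarrow> h \<in> hom K Y Z \<Longrightarrow>
      (h \<cdot> g) \<cdot> f = h \<cdot> (g \<cdot> f)"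

definition iso_arrow :: "('o, 'a, 'm) cat_scheme \<Rightarrow> 'a \<Rightarrow> bool" where
  "iso_arrow K f \<longleftrightarrow> f \<in> Ar K \<and>
     (\<exists>g \<in> hom K (tgt K f) (src K f).
        g \<cdot>\<^bsub>K\<^esub> f = ide K (src K f) \<and> f \<cdot>\<^bsub>K\<^esub> g = ide K (tgt K f))"

record ('o, 'a, 'p, 'b) ftor =
  fob :: "'o \<Rightarrow> 'p"
  far :: "'a \<Rightarrow> 'b"

text \<open>The object and arrow maps are \<open>undefined\<close> off the carriers, so that HOL equality of
  \<open>ftor\<close>s is equality of functors.\<close>

definition is_functor ::
  "('o, 'a, 'm) cat_scheme \<Rightarrow> ('p, 'b, 'n) cat_scheme \<Rightarrow> ('o, 'a, 'p, 'b) ftor \<Rightarrow> bool" where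
  "is_functor C D F \<longleftrightarrow>
     fob F \<in> Ob C \<rightarrow>\<^sub>E Ob D \<and> far F \<in> Ar C \<rightarrow>\<^sub>E Ar D \<and>
     (\<forall>f \<in> Ar C. src D (far F f) = fob F (src C f) \<and> tgt D (far F f) = fob F (tgt C f)) \<and>
     (\<forall>X \<in> Ob C. far F (ide C X) = ide D (fob F X)) \<and>
     (\<forall>f \<in> Ar C. \<forall>g \<in> Ar C. tgt C f = src C g \<longrightarrow>
        far F (g \<cdot>\<^bsub>C\<^esub> f) = far F g \<cdot>\<^bsub>D\<^esub> far F f)"

definition id_ftor :: "('o, 'a, 'm) cat_scheme \<Rightarrow> ('o, 'a, 'o, 'a) ftor" where
  "id_ftor C = \<lparr>fob = (\<lambda>X \<in> Ob C. X), far = (\<lambda>f \<in> Ar C. f)\<rparr>"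

definition comp_ftor ::
  "('o, 'a, 'm) cat_scheme \<Rightarrow> ('p, 'b, 'q, 'c) ftor \<Rightarrow> ('o, 'a, 'p, 'b) ftor
     \<Rightarrow> ('o, 'a, 'q, 'c) ftor" where
  "comp_ftor C G F = \<lparr>fob = compose (Ob C) (fob G) (fob F), far = compose (Ar C) (far G) (far F)\<rparr>"

definition naturally_isomorphic ::
  "('o, 'a, 'm) cat_scheme \<Rightarrow> ('p, 'b, 'n) cat_scheme
     \<Rightarrow> ('o, 'a, 'p, 'b) ftor \<Rightarrow> ('o, 'a, 'p, 'b) ftor \<Rightarrow> bool" where
  "naturally_isomorphic C D F G \<longleftrightarrow>
     (\<exists>\<eta>. (\<forall>X \<in> Ob C. \<eta> X \<in> hom D (fob F X) (fob G X) \<and> iso_arrow D (\<eta> X)) \<and>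
          (\<forall>f \<in> Ar C. \<eta> (tgt C f) \<cdot>\<^bsub>D\<^esub> far F f = far G f \<cdot>\<^bsub>D\<^esub> \<eta> (src C f)))"

definition equivalence ::
  "('o, 'a, 'm) cat_scheme \<Rightarrow> ('p, 'b, 'n) cat_scheme \<Rightarrow> ('o, 'a, 'p, 'b) ftor \<Rightarrow> bool" where
  "equivalence C D F \<longleftrightarrow> is_functor C D F \<and>
     (\<exists>G. is_functor D C G \<and>
          naturally_isomorphic C C (comp_ftor C G F) (id_ftor C) \<and>
          naturally_isomorphic D D (comp_ftor D F G) (id_ftor D))"


section \<open>Zero objects, pushouts, full subcategories\<close>

definition zero_object :: "('o, 'a, 'm) cat_scheme \<Rightarrow> 'o \<Rightarrow> bool" where
  "zero_object K Z \<longleftrightarrow> Z \<in> Ob K \<and>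
     (\<forall>X \<in> Ob K. (\<exists>!f. f \<in> hom K Z X) \<and> (\<exists>!f. f \<in> hom K X Z))"

text \<open>In the next definitions \<open>f\<close> is the top arrow, \<open>g\<close> the left arrow, \<open>h\<close> the right arrow
  (out of the target of \<open>f\<close>) and \<open>k\<close> the bottom arrow (out of the target of \<open>g\<close>).\<close>

definition comm_square :: "('o, 'a, 'm) cat_scheme \<Rightarrow> 'a \<Rightarrow> 'a \<Rightarrow> 'a \<Rightarrow> 'a \<Rightarrow> bool" where
  "comm_square K f g h k \<longleftrightarrow>
     f \<in> Ar K \<and> g \<in> Ar K \<and> h \<in> Ar K \<and> k \<in> Ar K \<and>
     src K f = src K g \<and> src K h = tgt K f \<and> src K k = tgt K g \<and> tgt K h = tgt K k \<and>
     h \<cdot>\<^bsub>K\<^esub> f = k \<cdot>\<^bsub>K\<^esub> g"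

definition pushout :: "('o, 'a, 'm) cat_scheme \<Rightarrow> 'a \<Rightarrow> 'a \<Rightarrow> 'a \<Rightarrow> 'a \<Rightarrow> bool" where
  "pushout K f g h k \<longleftrightarrow> comm_square K f g h k \<and>
     (\<forall>h' k'. comm_square K f g h' k' \<longrightarrow>
        (\<exists>!u. u \<in> hom K (tgt K h) (tgt K h') \<and> u \<cdot>\<^bsub>K\<^esub> h = h' \<and> u \<cdot>\<^bsub>K\<^esub> k = k'))"

definition full_subcat :: "('o, 'a) cat \<Rightarrow> 'o set \<Rightarrow> ('o, 'a) cat" where
  "full_subcat K A = K\<lparr>Ob := A, Ar := {f \<in> Ar K. src K f \<in> A \<and> tgt K f \<in> A}\<rparr>"


section \<open>Waldhausen categories and homotopy pushouts\<close>

locale waldhausen_category = category K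
  for K :: "('o, 'a, 'm) cat_scheme" (structure) +
  fixes cof weq :: "'a set"
  assumes zero: "\<exists>Z. zero_object K Z"
    and cof_Ar: "cof \<subseteq> Ar K"
    and cof_cmp: "f \<in> cof \<Longrightarrow> g \<in> cof \<Longrightarrow> tgt K f = src K g \<Longrightarrow> g \<cdot> f \<in> cof"
    and cof_iso: "iso_arrow K f \<Longrightarrow> f \<in> cof"
    and cof_zero: "zero_object K Z \<Longrightarrow> f \<in> hom K Z X \<Longrightarrow> f \<in> cof"
    and cof_pushout_ex: "f \<in> cof \<Longrightarrow> g \<in> Ar K \<Longrightarrow> src K f = src K g \<Longrightarrow> \<exists>h k. pushout K f g h k"
    and cof_pushout: "f \<in> cof \<Longrightarrow> pushout K f g h k \<Longrightarrow> k \<in> cof"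
    and weq_Ar: "weq \<subseteq> Ar K"
    and weq_cmp: "f \<in> weq \<Longrightarrow> g \<in> weq \<Longrightarrow> tgt K f = src K g \<Longrightarrow> g \<cdot> f \<in> weq"
    and weq_iso: "iso_arrow K f \<Longrightarrow> f \<in> weq"
    and gluing:
      "\<lbrakk> f \<in> cof; f' \<in> cof; pushout K f g h k; pushout K f' g' h' k';
         a \<in> weq; b \<in> weq; c \<in> weq;
         comm_square K f a b f'; comm_square K g a c g';
         u \<in> hom K (tgt K h) (tgt K h'); u \<cdot> h = h' \<cdot> b; u \<cdot> k = k' \<cdot> c \<rbrakk> \<Longrightarrow> u \<in> weq"

text \<open>A commutative square is a homotopy pushout if, after replacing its top arrow \<open>f\<close> by a
  cofibration \<open>i\<close> (\<open>f = p \<cdot> i\<close> with \<open>p\<close> a weak equivalence), the comparison arrow from the strict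
  pushout of \<open>i\<close> and \<open>g\<close> to the corner is a weak equivalence.  Replacing a single leg is
  correct only where all objects are cofibrant (or the model structure is left proper); there
  the condition does not depend on the chosen replacement.\<close>

definition homotopy_pushout ::
  "('o, 'a, 'm) cat_scheme \<Rightarrow> 'a set \<Rightarrow> 'a set \<Rightarrow> 'a \<Rightarrow> 'a \<Rightarrow> 'a \<Rightarrow> 'a \<Rightarrow> bool" where
  "homotopy_pushout K cof weq f g h k \<longleftrightarrow> comm_square K f g h k \<and>
     (\<exists>i p h' k' u. i \<in> cof \<and> p \<in> weq \<and> tgt K i = src K p \<and> p \<cdot>\<^bsub>K\<^esub> i = f \<and>
        pushout K i g h' k' \<and>
        u \<in> hom K (tgt K h') (tgt K h) \<and> u \<cdot>\<^bsub>K\<^esub> h' = h \<cdot>\<^bsub>K\<^esub> p \<and> u \<cdot>\<^bsub>K\<^esub> k' = k \<and>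
        u \<in> weq)"


section \<open>Pointed small categories\<close>

text \<open>The type \<open>'u\<close> plays the role of the universe: a category is small if its objects and its
  arrows are elements of \<open>'u\<close>.  A functor from the terminal category is recorded as the object
  it picks out.  The structure maps are required to be \<open>undefined\<close> off the carriers, so that
  HOL equality is equality of pointed categories.\<close>

record 'u pcat = "('u, 'u) cat" +
  pt :: 'u

type_synonym 'u pmap = "'u pcat \<times> ('u, 'u, 'u, 'u) ftor \<times> 'u pcat"

definition pointed_category :: "'u pcat \<Rightarrow> bool" where
  "pointed_category C \<longleftrightarrow> category C \<and> pt C \<in> Ob C \<and>
     src C \<in> extensional (Ar C) \<and> tgt C \<in> extensional (Ar C) \<and> ide C \<in> extensional (Ob C) \<and>
     (\<forall>g f. \<not> (f \<in> Ar C \<and> g \<in> Ar C \<and> tgt C f = src C g) \<longrightarrow> g \<cdot>\<^bsub>C\<^esub> f = undefined)"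

definition SmCatP :: "('u pcat, 'u pmap) cat" where
  "SmCatP = \<lparr>
     Ob = {C. pointed_category C},
     Ar = {(C, F, D). pointed_category C \<and> pointed_category D \<and>
                      is_functor C D F \<and> fob F (pt C) = pt D},
     src = (\<lambda>(C, F, D). C),
     tgt = (\<lambda>(C, F, D). D),
     ide = (\<lambda>C. (C, id_ftor C, C)),
     cmp = (\<lambda>(_, G, E) (C, F, _). (C, comp_ftor C G F, E)) \<rparr>"

definition cofibrations :: "'u pmap set" where
  "cofibrations = {(C, F, D) \<in> Ar SmCatP. inj_on (fob F) (Ob C)}"

definition weak_equivalences :: "'u pmap set" where
  "weak_equivalences = {(C, F, D) \<in> Ar SmCatP. equivalence C D F}"

definition full_sub_waldhausen :: "'u pcat set \<Rightarrow> bool" where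
  "full_sub_waldhausen A \<longleftrightarrow> A \<subseteq> Ob SmCatP \<and> (\<exists>Z \<in> A. zero_object SmCatP Z) \<and>
     waldhausen_category (full_subcat SmCatP A)
       (cofibrations \<inter> Ar (full_subcat SmCatP A))
       (weak_equivalences \<inter> Ar (full_subcat SmCatP A))"

definition is_chaotic_on :: "'u pcat \<Rightarrow> 'u pcat \<Rightarrow> bool" where
  "is_chaotic_on C C' \<longleftrightarrow> pointed_category C' \<and> Ob C' = Ob C \<and> pt C' = pt C \<and>
     (\<forall>X \<in> Ob C. \<forall>Y \<in> Ob C. \<exists>!f. f \<in> hom C' X Y)"

text \<open>The terminal category \<open>1\<close> is only determined up to isomorphism in \<open>SmCatP\<close>, so \<open>Z\<close>
  ranges over all of its copies.\<close>

definition cofiber_additive :: "'u pcat set \<Rightarrow> ('u pcat \<Rightarrow> 'g::ab_group_add) \<Rightarrow> bool" where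
  "cofiber_additive A \<chi> \<longleftrightarrow>
     (\<forall>C \<in> A. \<forall>D \<in> A. \<forall>E \<in> A.
        (\<exists>Z f g h k. zero_object SmCatP Z \<and>
           f \<in> hom SmCatP C D \<and> g \<in> hom SmCatP C Z \<and> h \<in> hom SmCatP D E \<and> k \<in> hom SmCatP Z E \<and>
           homotopy_pushout SmCatP cofibrations weak_equivalences f g h k)
        \<longrightarrow> \<chi> D = \<chi> C + \<chi> E)"

end

theory Submission
  imports Defs
begin

text \<open>The comparison functor from \<open>C\<close> to the chaotic category \<open>C'\<close> on its objects is bijective on
  objects, so its cofiber \<open>E\<close> has a single object.  A chaotic category is equivalent to \<open>1\<close>, hence
  \<open>\<chi> C' = 0\<close>.  For a category \<open>E\<close> with one object, \<open>E \<rightarrow> 1\<close> is both a cofibration and a split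
  epimorphism, so its cofiber is \<open>1\<close> and \<open>\<chi> E = 0\<close>.  Additivity then forces \<open>\<chi> C = 0\<close>.\<close>

section \<open>Full subcategories and pushouts\<close>

lemma full_subcat_simps [simp]:
  "Ob (full_subcat K A) = A"
  "Ar (full_subcat K A) = {f \<in> Ar K. src K f \<in> A \<and> tgt K f \<in> A}"
  "src (full_subcat K A) = src K"
  "tgt (full_subcat K A) = tgt K"
  "ide (full_subcat K A) = ide K"
  "cmp (full_subcat K A) = cmp K"
  by (simp_all add: full_subcat_def)

lemma hom_full_subcat:
  assumes "X \<in> A" "Y \<in> A"
  shows "hom (full_subcat K A) X Y = hom K X Y"
  using assms by (auto simp: hom_def)

lemma zero_object_full_subcat:
  assumes "zero_object K Z" "Z \<in> A" "A \<subseteq> Ob K"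
  shows "zero_object (full_subcat K A) Z"
  using assms by (auto simp: zero_object_def hom_full_subcat subset_iff)

lemma comm_square_homI:
  assumes "f \<in> hom K X Y" "g \<in> hom K X Z" "h \<in> hom K Y W" "k \<in> hom K Z W"
    and "h \<cdot>\<^bsub>K\<^esub> f = k \<cdot>\<^bsub>K\<^esub> g"
  shows "comm_square K f g h k"
  using assms by (simp add: comm_square_def hom_def)

section \<open>Two strict pushout squares valid in any category\<close>

context category
begin

lemma iso_arrow_ide:
  assumes "X \<in> Ob K"
  shows "iso_arrow K (ide K X)"
  using ide_hom[OF assms] cmp_ide[OF ide_hom[OF assms]] by (auto simp: iso_arrow_def hom_def)

text \<open>With an identity on top, any competing cocone satisfies
  \<open>h' = k' \<cdot> f\<close>, so \<open>k'\<close> itself is the only mediating arrow. This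
  computes the cofiber of an identity.\<close>

lemma pushout_ide:
  assumes f: "f \<in> hom K X Z" and X: "X \<in> Ob K" and Z: "Z \<in> Ob K"
  shows "pushout K (ide K X) f f (ide K Z)"
  unfolding pushout_def
proof (intro conjI allI impI)
  show "comm_square K (ide K X) f f (ide K Z)"
    using f ide_hom[OF X] ide_hom[OF Z] cmp_ide[OF f] ide_cmp[OF f]
    by (intro comm_square_homI) auto
next
  fix h' k' assume sq: "comm_square K (ide K X) f h' k'"
  define W where "W = tgt K k'"
  have k': "k' \<in> hom K Z W" and h': "h' \<in> hom K X W" and eq: "h' \<cdot> ide K X = k' \<cdot> f"
    using sq f ide_hom[OF X] by (auto simp: comm_square_def hom_def W_def)
  have "h' = k' \<cdot> f" using eq cmp_ide[OF h'] by simp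
  moreover have "tgt K f = Z" "tgt K h' = W" using f h' by (auto simp: hom_def)
  ultimately show "\<exists>!u. u \<in> hom K (tgt K f) (tgt K h') \<and> u \<cdot> f = h' \<and> u \<cdot> ide K Z = k'"
    using k' cmp_ide by metis
qed

text \<open>The section \<open>s\<close> cancels \<open>f\<close> on the right, so the two legs of
  any cocone coincide and the common leg mediates. It is applied to
  \<open>E \<rightarrow> 1\<close>, split by the base point of \<open>E\<close>.\<close>

lemma pushout_split_epi:
  assumes f: "f \<in> hom K X Z" and s: "s \<in> hom K Z X" and fs: "f \<cdot> s = ide K Z" and Z: "Z \<in> Ob K"
  shows "pushout K f f (ide K Z) (ide K Z)"
  unfolding pushout_def
proof (intro conjI allI impI)
  show "comm_square K f f (ide K Z) (ide K Z)"
    using f ide_hom[OF Z] by (intro comm_square_homI) auto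
next
  fix h' k' assume sq: "comm_square K f f h' k'"
  define W where "W = tgt K k'"
  have k': "k' \<in> hom K Z W" and h': "h' \<in> hom K Z W" and eq: "h' \<cdot> f = k' \<cdot> f"
    using sq f by (auto simp: comm_square_def hom_def W_def)
  have "h' = h' \<cdot> (f \<cdot> s)" using cmp_ide[OF h'] fs by simp
  also have "\<dots> = k' \<cdot> (f \<cdot> s)" using cmp_assoc[OF s f h'] cmp_assoc[OF s f k'] eq by simp
  also have "\<dots> = k'" using cmp_ide[OF k'] fs by simp
  finally have "h' = k'" .
  moreover have "tgt K (ide K Z) = Z" "tgt K h' = W" using ide_hom[OF Z] h' by (auto simp: hom_def)
  ultimately show "\<exists>!u. u \<in> hom K (tgt K (ide K Z)) (tgt K h') \<and>
      u \<cdot> ide K Z = h' \<and> u \<cdot> ide K Z = k'"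
    using k' cmp_ide by metis
qed

end


section \<open>Chaotic categories\<close>

text \<open>The arrow clause of \<open>is_chaotic_on\<close> by itself, free of base points and of
  the reference category.\<close>

definition chaotic :: "('o, 'a, 'm) cat_scheme \<Rightarrow> bool" where
  "chaotic D \<longleftrightarrow> (\<forall>X \<in> Ob D. \<forall>Y \<in> Ob D. \<exists>!f. f \<in> hom D X Y)"

lemma chaotic_eq:
  assumes "chaotic D" "f \<in> hom D X Y" "g \<in> hom D X Y" "X \<in> Ob D" "Y \<in> Ob D"
  shows "f = g"
  using assms unfolding chaotic_def by blast

section \<open>Functors into a chaotic category\<close>

lemma functor_arrow:
  assumes "is_functor C D F" "f \<in> Ar C"
  shows "far F f \<in> hom D (fob F (src C f)) (fob F (tgt C f))"
  using assms by (auto simp: is_functor_def hom_def PiE_def)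

lemma functor_object:
  assumes "is_functor C D F" "X \<in> Ob C"
  shows "fob F X \<in> Ob D"
  using assms by (auto simp: is_functor_def)

text \<open>An arrow of \<open>D\<close> is fixed by its endpoints, so agreement on objects forces
  agreement on arrows. Off the carriers both functors are \<open>undefined\<close>, which makes this
  an HOL equality.\<close>

lemma functor_into_chaotic_unique:
  assumes "category C" "chaotic D" and F: "is_functor C D F" and G: "is_functor C D G"
    and eq: "\<And>X. X \<in> Ob C \<Longrightarrow> fob F X = fob G X"
  shows "F = G"
proof -
  interpret category C by fact
  have "fob F \<in> Ob C \<rightarrow>\<^sub>E Ob D" "fob G \<in> Ob C \<rightarrow>\<^sub>E Ob D"
    and far: "far F \<in> Ar C \<rightarrow>\<^sub>E Ar D" "far G \<in> Ar C \<rightarrow>\<^sub>E Ar D"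
    using F G by (auto simp: is_functor_def)
  then have "fob F = fob G" using eq by (intro PiE_ext) auto
  moreover have "far F = far G"
  proof (rule PiE_ext[OF far])
    fix f assume f: "f \<in> Ar C"
    show "far F f = far G f"
      using functor_arrow[OF F f] functor_arrow[OF G f] eq src_Ob[OF f] tgt_Ob[OF f]
        functor_object[OF F] chaotic_eq[OF \<open>chaotic D\<close>] by metis
  qed
  ultimately show ?thesis by (simp add: ftor.equality)
qed

text \<open>Each arrow of \<open>C\<close> goes to the unique arrow between the images of its ends;
  the laws for identities and composites then compare parallel arrows of \<open>D\<close>.\<close>

lemma functor_into_chaotic_exists:
  assumes "category C" "category D" "chaotic D" and \<phi>: "\<phi> \<in> Ob C \<rightarrow> Ob D"
  obtains F where "is_functor C D F" "\<And>X. X \<in> Ob C \<Longrightarrow> fob F X = \<phi> X"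
proof -
  interpret C: category C by fact
  interpret D: category D by fact
  define m where "m X Y = (THE f. f \<in> hom D X Y)" for X Y
  have m: "m X Y \<in> hom D X Y" if "X \<in> Ob D" "Y \<in> Ob D" for X Y
    unfolding m_def using that \<open>chaotic D\<close> by (intro theI'[where P = "\<lambda>f. f \<in> hom D _ _"]) (auto simp: chaotic_def)
  define F where "F = \<lparr>fob = \<lambda>X \<in> Ob C. \<phi> X, far = \<lambda>f \<in> Ar C. m (\<phi> (src C f)) (\<phi> (tgt C f))\<rparr>"
  have \<phi>': "\<phi> X \<in> Ob D" if "X \<in> Ob C" for X using \<phi> that by auto
  have mf: "m (\<phi> (src C f)) (\<phi> (tgt C f)) \<in> hom D (\<phi> (src C f)) (\<phi> (tgt C f))" if "f \<in> Ar C" for f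
    using m \<phi>' C.src_Ob C.tgt_Ob that by auto
  have "is_functor C D F"
    unfolding is_functor_def
  proof (intro conjI ballI impI)
    show "fob F \<in> Ob C \<rightarrow>\<^sub>E Ob D" using \<phi> by (auto simp: F_def)
    show "far F \<in> Ar C \<rightarrow>\<^sub>E Ar D" using mf by (auto simp: F_def hom_def)
  next
    fix f assume f: "f \<in> Ar C"
    show "src D (far F f) = fob F (src C f)" "tgt D (far F f) = fob F (tgt C f)"
      using mf[OF f] f C.src_Ob[OF f] C.tgt_Ob[OF f] by (auto simp: F_def hom_def)
  next
    fix X assume X: "X \<in> Ob C"
    have "ide C X \<in> Ar C" "src C (ide C X) = X" "tgt C (ide C X) = X"
      using C.ide_hom[OF X] by (auto simp: hom_def)
    then show "far F (ide C X) = ide D (fob F X)"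
      using m[OF \<phi>'[OF X] \<phi>'[OF X]] D.ide_hom[OF \<phi>'[OF X]] \<phi>'[OF X] X
      by (auto simp: F_def intro: chaotic_eq[OF \<open>chaotic D\<close>])
  next
    fix f g assume f: "f \<in> Ar C" and g: "g \<in> Ar C" and fg: "tgt C f = src C g"
    have "g \<cdot>\<^bsub>C\<^esub> f \<in> hom C (src C f) (tgt C g)"
      using f g fg by (intro C.cmp_hom) (auto simp: hom_def)
    then have gf: "g \<cdot>\<^bsub>C\<^esub> f \<in> Ar C" "src C (g \<cdot>\<^bsub>C\<^esub> f) = src C f" "tgt C (g \<cdot>\<^bsub>C\<^esub> f) = tgt C g"
      by (auto simp: hom_def)
    have "m (\<phi> (src C f)) (\<phi> (tgt C g)) =
        m (\<phi> (src C g)) (\<phi> (tgt C g)) \<cdot>\<^bsub>D\<^esub> m (\<phi> (src C f)) (\<phi> (tgt C f))"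
      using mf[OF f] mf[OF g] m fg \<phi>' C.src_Ob[OF f] C.tgt_Ob[OF g]
      by (intro chaotic_eq[OF \<open>chaotic D\<close>] D.cmp_hom) auto
    then show "far F (g \<cdot>\<^bsub>C\<^esub> f) = far F g \<cdot>\<^bsub>D\<^esub> far F f"
      using f g gf by (simp add: F_def)
  qed
  moreover have "fob F X = \<phi> X" if "X \<in> Ob C" for X using that by (simp add: F_def)
  ultimately show ?thesis by (rule that)
qed

text \<open>The components are forced, and naturality compares parallel arrows. Every arrow of
  \<open>D\<close> is invertible: composed with the unique arrow back it gives endomorphisms, which
  must be identities.\<close>

lemma naturally_isomorphic_chaotic:
  assumes "category C" "category D" "chaotic D" and F: "is_functor C D F" and G: "is_functor C D G"
  shows "naturally_isomorphic C D F G"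
proof -
  interpret C: category C by fact
  interpret D: category D by fact
  define \<eta> where "\<eta> X = (THE f. f \<in> hom D (fob F X) (fob G X))" for X
  have \<eta>: "\<eta> X \<in> hom D (fob F X) (fob G X)" if "X \<in> Ob C" for X
    unfolding \<eta>_def using functor_object[OF F that] functor_object[OF G that] \<open>chaotic D\<close>
    by (intro theI'[where P = "\<lambda>f. f \<in> hom D _ _"]) (auto simp: chaotic_def)
  have "iso_arrow D f" if f_Ar: "f \<in> Ar D" for f
  proof -
    have f: "f \<in> hom D (src D f) (tgt D f)" using f_Ar by (simp add: hom_def)
    obtain g where g: "g \<in> hom D (tgt D f) (src D f)"
      using \<open>chaotic D\<close> D.src_Ob[OF f_Ar] D.tgt_Ob[OF f_Ar] unfolding chaotic_def by blast
    have "g \<cdot>\<^bsub>D\<^esub> f = ide D (src D f)" "f \<cdot>\<^bsub>D\<^esub> g = ide D (tgt D f)"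
      using D.cmp_hom[OF f g] D.cmp_hom[OF g f] D.src_Ob[OF f_Ar] D.tgt_Ob[OF f_Ar] D.ide_hom
      by (auto intro: chaotic_eq[OF \<open>chaotic D\<close>])
    then show ?thesis using g f_Ar by (auto simp: iso_arrow_def)
  qed
  moreover have "\<eta> (tgt C f) \<cdot>\<^bsub>D\<^esub> far F f = far G f \<cdot>\<^bsub>D\<^esub> \<eta> (src C f)" if f: "f \<in> Ar C" for f
    using D.cmp_hom[OF functor_arrow[OF F f] \<eta>[OF C.tgt_Ob[OF f]]]
      D.cmp_hom[OF \<eta>[OF C.src_Ob[OF f]] functor_arrow[OF G f]]
      functor_object[OF F C.src_Ob[OF f]] functor_object[OF G C.tgt_Ob[OF f]]
    by (rule chaotic_eq[OF \<open>chaotic D\<close>])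
  ultimately show ?thesis
    unfolding naturally_isomorphic_def using \<eta> by (intro exI[of _ \<eta>]) (auto simp: hom_def)
qed

lemma naturally_isomorphic_id_ftor:
  assumes "category C"
  shows "naturally_isomorphic C C (id_ftor C) (id_ftor C)"
proof -
  interpret category C by fact
  have "ide C (tgt C f) \<cdot>\<^bsub>C\<^esub> f = f \<cdot>\<^bsub>C\<^esub> ide C (src C f)" if "f \<in> Ar C" for f
    using cmp_ide[of f "src C f" "tgt C f"] ide_cmp[of f "src C f" "tgt C f"] that
    by (simp add: hom_def)
  then show ?thesis
    unfolding naturally_isomorphic_def
    by (intro exI[of _ "ide C"]) (auto simp: id_ftor_def ide_hom iso_arrow_ide)
qed


section \<open>Pointed categories\<close>

lemma SmCatP_simps [simp]:
  "Ob SmCatP = {C. pointed_category C}"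
  "src SmCatP (C, F, D) = C"
  "tgt SmCatP (C, F, D) = D"
  "(D', G, E) \<cdot>\<^bsub>SmCatP\<^esub> (C, F, D) = (C, comp_ftor C G F, E)"
  by (simp_all add: SmCatP_def)

lemma ide_SmCatP: "ide SmCatP C = (C, id_ftor C, C)"
  by (simp add: SmCatP_def)

lemma hom_SmCatP_iff:
  "x \<in> hom SmCatP C D \<longleftrightarrow> pointed_category C \<and> pointed_category D \<and>
     (\<exists>F. x = (C, F, D) \<and> is_functor C D F \<and> fob F (pt C) = pt D)"
  by (auto simp: hom_def SmCatP_def)

lemma pointed_map_into_chaotic_exists:
  assumes "pointed_category C" "pointed_category D" "chaotic D"
    and "\<phi> \<in> Ob C \<rightarrow> Ob D" "\<phi> (pt C) = pt D"
  obtains F where "(C, F, D) \<in> hom SmCatP C D" "\<And>X. X \<in> Ob C \<Longrightarrow> fob F X = \<phi> X"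
proof -
  have "category C" "category D" "pt C \<in> Ob C" using assms by (auto simp: pointed_category_def)
  then obtain F where "is_functor C D F" "\<And>X. X \<in> Ob C \<Longrightarrow> fob F X = \<phi> X"
    using functor_into_chaotic_exists assms(3,4) by metis
  then show ?thesis
    using assms \<open>pt C \<in> Ob C\<close> by (intro that[of F]) (auto simp: hom_SmCatP_iff)
qed

lemma is_chaotic_onD:
  assumes "is_chaotic_on C D"
  shows "chaotic D" "pointed_category D" "Ob D = Ob C" "pt D = pt C"
  using assms by (simp_all add: is_chaotic_on_def chaotic_def)

text \<open>The category laws for \<open>SmCatP\<close> are used on objects of \<open>A\<close>
  only, where the Waldhausen hypothesis supplies them. The lemmas below carry them over from the
  full subcategory, whose homs and composition are the same.\<close>

locale pointed_subcategory =
  category "full_subcat SmCatP A" for A :: "'u pcat set" +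
  assumes A_sub: "A \<subseteq> Ob SmCatP"
begin

lemma pointed_category_A: "C \<in> A \<Longrightarrow> pointed_category C"
  using A_sub by auto

lemma ide_hom_SmCatP: "C \<in> A \<Longrightarrow> ide SmCatP C \<in> hom SmCatP C C"
  using ide_hom by (auto simp: hom_full_subcat)

lemma cmp_hom_SmCatP:
  assumes "f \<in> hom SmCatP C D" "g \<in> hom SmCatP D E" "C \<in> A" "D \<in> A" "E \<in> A"
  shows "g \<cdot>\<^bsub>SmCatP\<^esub> f \<in> hom SmCatP C E"
  using cmp_hom[of f C D g E] assms by (simp add: hom_full_subcat)

lemma ide_cmp_SmCatP:
  assumes "f \<in> hom SmCatP C D" "C \<in> A" "D \<in> A"
  shows "ide SmCatP D \<cdot>\<^bsub>SmCatP\<^esub> f = f" "f \<cdot>\<^bsub>SmCatP\<^esub> ide SmCatP C = f"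
  using ide_cmp[of f C D] cmp_ide[of f C D] assms by (simp_all add: hom_full_subcat)

lemma cmp_assoc_SmCatP:
  assumes "f \<in> hom SmCatP B C" "g \<in> hom SmCatP C D" "h \<in> hom SmCatP D E"
    "B \<in> A" "C \<in> A" "D \<in> A" "E \<in> A"
  shows "(h \<cdot>\<^bsub>SmCatP\<^esub> g) \<cdot>\<^bsub>SmCatP\<^esub> f = h \<cdot>\<^bsub>SmCatP\<^esub> (g \<cdot>\<^bsub>SmCatP\<^esub> f)"
  using cmp_assoc[of f B C g D h E] assms by (simp add: hom_full_subcat)

lemma zero_arrow_eq:
  assumes "zero_object SmCatP Z" "C \<in> A"
  shows "f \<in> hom SmCatP Z C \<Longrightarrow> g \<in> hom SmCatP Z C \<Longrightarrow> f = g"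
    and "f \<in> hom SmCatP C Z \<Longrightarrow> g \<in> hom SmCatP C Z \<Longrightarrow> f = g"
  using assms A_sub unfolding zero_object_def by blast+

text \<open>The arrow \<open>s\<close> back from the zero object is a quasi-inverse:
  \<open>t \<cdot> s\<close> is strictly the identity, while \<open>s \<cdot> t\<close> and the
  identity are parallel functors into a chaotic category, hence naturally isomorphic.\<close>

lemma weak_equivalence_chaotic_zero:
  assumes "C \<in> A" "Z \<in> A" "chaotic C" and Z: "zero_object SmCatP Z" and t: "t \<in> hom SmCatP C Z"
  shows "t \<in> weak_equivalences"
proof -
  have C: "pointed_category C" "pointed_category Z" using assms pointed_category_A by auto
  then obtain s where s: "s \<in> hom SmCatP Z C" using Z by (auto simp: zero_object_def)
  obtain T where T: "t = (C, T, Z)" "is_functor C Z T"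
    using t by (auto simp: hom_SmCatP_iff)
  obtain S where S: "s = (Z, S, C)" "is_functor Z C S"
    using s by (auto simp: hom_SmCatP_iff)
  have "t \<cdot>\<^bsub>SmCatP\<^esub> s \<in> hom SmCatP Z Z" using cmp_hom_SmCatP s t assms by blast
  then have "t \<cdot>\<^bsub>SmCatP\<^esub> s = ide SmCatP Z"
    using zero_arrow_eq[OF Z] ide_hom_SmCatP assms by blast
  then have TS: "comp_ftor Z T S = id_ftor Z" using T S by (simp add: ide_SmCatP)
  have "s \<cdot>\<^bsub>SmCatP\<^esub> t \<in> hom SmCatP C C" using cmp_hom_SmCatP s t assms by blast
  then have "is_functor C C (comp_ftor C S T)" using T S by (auto simp: hom_SmCatP_iff)
  moreover have "is_functor C C (id_ftor C)"
    using ide_hom_SmCatP assms by (auto simp: hom_SmCatP_iff ide_SmCatP)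
  ultimately have "naturally_isomorphic C C (comp_ftor C S T) (id_ftor C)"
    using \<open>chaotic C\<close> C by (intro naturally_isomorphic_chaotic) (auto simp: pointed_category_def)
  then have "equivalence C Z T"
    unfolding equivalence_def using T S TS naturally_isomorphic_id_ftor[of Z] C
    by (auto simp: pointed_category_def)
  then show ?thesis using t T by (auto simp: weak_equivalences_def hom_def)
qed

text \<open>The pointed functors \<open>E \<rightarrow> E'\<close> that are constant, respectively the identity, on objects agree
  on the pushout cocone, hence are equal.\<close>

lemma cofiber_single_object:
  assumes A: "C \<in> A" "C' \<in> A" "Z \<in> A" "E \<in> A" "E' \<in> A"
    and Z: "zero_object SmCatP Z"
    and E': "is_chaotic_on E E'"
    and i: "i \<in> hom SmCatP C C'" and surj: "fob (fst (snd i)) ` Ob C = Ob C'"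
    and t: "t \<in> hom SmCatP C Z"
    and po: "pushout SmCatP i t h k" and h: "h \<in> hom SmCatP C' E" and k: "k \<in> hom SmCatP Z E"
  shows "Ob E = {pt E}"
proof -
  note E' = is_chaotic_onD[OF E']
  have E: "pointed_category E" and ptE: "pt E \<in> Ob E"
    using A pointed_category_A by (auto simp: pointed_category_def)
  \<comment> \<open>Both object maps fix \<open>pt E\<close>, which is also the base point of
    \<open>E'\<close>, so \<open>U\<close> and \<open>V\<close> are pointed.\<close>
  obtain U where u: "(E, U, E') \<in> hom SmCatP E E'" and U: "\<And>X. X \<in> Ob E \<Longrightarrow> fob U X = pt E"
    by (rule pointed_map_into_chaotic_exists[of E E' "\<lambda>_. pt E"]) (use E E' ptE in auto)
  obtain V where v: "(E, V, E') \<in> hom SmCatP E E'" and V: "\<And>X. X \<in> Ob E \<Longrightarrow> fob V X = X"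
    by (rule pointed_map_into_chaotic_exists[of E E' "\<lambda>X. X"]) (use E E' in auto)
  obtain I where I: "i = (C, I, C')" "is_functor C C' I" using i by (auto simp: hom_SmCatP_iff)
  obtain H where H: "h = (C', H, E)" "is_functor C' E H" using h by (auto simp: hom_SmCatP_iff)
  obtain K where K: "k = (Z, K, E)" "is_functor Z E K" using k by (auto simp: hom_SmCatP_iff)
  obtain T where T: "t = (C, T, Z)" "is_functor C Z T" using t by (auto simp: hom_SmCatP_iff)
  have sq: "h \<cdot>\<^bsub>SmCatP\<^esub> i = k \<cdot>\<^bsub>SmCatP\<^esub> t" using po by (simp add: pushout_def comm_square_def)
  have uk: "(E, U, E') \<cdot>\<^bsub>SmCatP\<^esub> k \<in> hom SmCatP Z E'" using cmp_hom_SmCatP k u A by blast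
  have vk: "(E, V, E') \<cdot>\<^bsub>SmCatP\<^esub> k \<in> hom SmCatP Z E'" using cmp_hom_SmCatP k v A by blast
  have uh: "(E, U, E') \<cdot>\<^bsub>SmCatP\<^esub> h \<in> hom SmCatP C' E'" using cmp_hom_SmCatP h u A by blast
  have vh: "(E, V, E') \<cdot>\<^bsub>SmCatP\<^esub> h \<in> hom SmCatP C' E'" using cmp_hom_SmCatP h v A by blast
  have k_eq: "(E, U, E') \<cdot>\<^bsub>SmCatP\<^esub> k = (E, V, E') \<cdot>\<^bsub>SmCatP\<^esub> k"
    using zero_arrow_eq(1)[OF Z _ uk vk] A by simp
  have K_eq: "fob U (fob K X) = fob V (fob K X)" if "X \<in> Ob Z" for X
  proof -
    have "fob (comp_ftor Z U K) X = fob (comp_ftor Z V K) X" using k_eq K by simp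
    then show ?thesis using that by (simp add: comp_ftor_def compose_eq)
  qed
  \<comment> \<open>By surjectivity of \<open>I\<close>, an object of \<open>C'\<close> comes from
    some \<open>Y\<close> in \<open>C\<close>; commutativity then places its image under
    \<open>H\<close> in the image of \<open>K\<close>, where \<open>U\<close> and \<open>V\<close>
    agree because \<open>Z\<close> is initial.\<close>
  have H_eq: "fob U (fob H X) = fob V (fob H X)" if X: "X \<in> Ob C'" for X
  proof -
    obtain Y where Y: "Y \<in> Ob C" "X = fob I Y" using surj I(1) X by auto
    have "fob (comp_ftor C H I) Y = fob (comp_ftor C K T) Y" using sq I H K T by simp
    then have "fob H X = fob K (fob T Y)" using Y by (simp add: comp_ftor_def compose_eq)
    then show ?thesis using K_eq functor_object[OF T(2) Y(1)] by simp
  qed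
  \<comment> \<open>Agreement on objects suffices, as \<open>E'\<close> is chaotic.\<close>
  have "comp_ftor C' U H = comp_ftor C' V H"
    using uh vh H H_eq E' pointed_category_A[OF A(2)]
    by (intro functor_into_chaotic_unique[of C' E'])
      (auto simp: hom_SmCatP_iff pointed_category_def comp_ftor_def compose_eq)
  then have h_eq: "(E, U, E') \<cdot>\<^bsub>SmCatP\<^esub> h = (E, V, E') \<cdot>\<^bsub>SmCatP\<^esub> h" using H by simp
  have "comm_square SmCatP i t ((E, U, E') \<cdot>\<^bsub>SmCatP\<^esub> h) ((E, U, E') \<cdot>\<^bsub>SmCatP\<^esub> k)"
    using cmp_assoc_SmCatP[OF i h u] cmp_assoc_SmCatP[OF t k u] A sq
    by (intro comm_square_homI[OF i t uh uk]) simp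
  then have "\<exists>!w. w \<in> hom SmCatP (tgt SmCatP h) (tgt SmCatP ((E, U, E') \<cdot>\<^bsub>SmCatP\<^esub> h)) \<and>
      w \<cdot>\<^bsub>SmCatP\<^esub> h = (E, U, E') \<cdot>\<^bsub>SmCatP\<^esub> h \<and> w \<cdot>\<^bsub>SmCatP\<^esub> k = (E, U, E') \<cdot>\<^bsub>SmCatP\<^esub> k"
    using po unfolding pushout_def by blast
  moreover have "tgt SmCatP h = E" "tgt SmCatP ((E, U, E') \<cdot>\<^bsub>SmCatP\<^esub> h) = E'" using H by auto
  \<comment> \<open>Only uniqueness of the mediating arrow is kept: \<open>U\<close> and
    \<open>V\<close> both mediate the cocone built from \<open>U\<close>.\<close>
  ultimately obtain w where w: "\<And>x. \<lbrakk>x \<in> hom SmCatP E E'; x \<cdot>\<^bsub>SmCatP\<^esub> h = (E, U, E') \<cdot>\<^bsub>SmCatP\<^esub> h;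
      x \<cdot>\<^bsub>SmCatP\<^esub> k = (E, U, E') \<cdot>\<^bsub>SmCatP\<^esub> k\<rbrakk> \<Longrightarrow> x = w"
    by (elim ex1E) (simp only:, blast)
  have "(E, U, E') = w" by (intro w u refl)
  moreover have "(E, V, E') = w" by (intro w v h_eq[symmetric] k_eq[symmetric])
  ultimately have "U = V" by auto
  \<comment> \<open>On an object \<open>X\<close> of \<open>E\<close> this reads
    \<open>pt E = X\<close>.\<close>
  then have "fob U X = fob V X" for X by simp
  then show ?thesis using U V ptE by fastforce
qed

end


section \<open>Euler characteristics\<close>

text \<open>The equivalence also records that the zero function is cofiber-additive. The chaotic
  category is determined only up to renaming its arrows, so closure of \<open>A\<close> asks for
  some copy of it.\<close>

theorem mainTheorem9:
  fixes A :: "'u pcat set" and \<chi> :: "'u pcat \<Rightarrow> 'g::ab_group_add"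
  assumes "infinite (UNIV :: 'u set)"
    and "full_sub_waldhausen A"
    and "\<And>f g h k. f \<in> cofibrations \<Longrightarrow> pushout (full_subcat SmCatP A) f g h k \<Longrightarrow>
           pushout SmCatP f g h k"
    and "\<And>C. C \<in> A \<Longrightarrow> \<exists>C' \<in> A. is_chaotic_on C C'"
  shows "cofiber_additive A \<chi> \<longleftrightarrow> (\<forall>C \<in> A. \<chi> C = 0)"
proof
  assume "\<forall>C \<in> A. \<chi> C = 0"
  then show "cofiber_additive A \<chi>" by (simp add: cofiber_additive_def)
next
  assume add: "cofiber_additive A \<chi>"
  let ?K = "full_subcat SmCatP A"
  interpret W: waldhausen_category ?K "cofibrations \<inter> Ar ?K" "weak_equivalences \<inter> Ar ?K"
    using assms(2) by (simp add: full_sub_waldhausen_def)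
  interpret pointed_subcategory A
    using assms(2) by unfold_locales (simp add: full_sub_waldhausen_def)
  obtain Z where Z: "Z \<in> A" "zero_object SmCatP Z"
    using assms(2) by (auto simp: full_sub_waldhausen_def)
  \<comment> \<open>Identities are isomorphisms, and the Waldhausen axioms put isomorphisms in both
    classes.\<close>
  have cof: "ide SmCatP C \<in> cofibrations" and weq: "ide SmCatP C \<in> weak_equivalences"
    if "C \<in> A" for C
    using W.cof_iso[OF W.iso_arrow_ide] W.weq_iso[OF W.iso_arrow_ide] that by auto
  have to_zero: "\<exists>t. t \<in> hom SmCatP C Z" and from_zero: "\<exists>s. s \<in> hom SmCatP Z C"
    if "C \<in> A" for C
    using Z A_sub that unfolding zero_object_def by blast+
  have hom: "hom ?K C D = hom SmCatP C D" if "C \<in> A" "D \<in> A" for C D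
    using that by (rule hom_full_subcat)

  \<comment> \<open>Additivity in the form used below: the top arrow comes already factored as
    \<open>p \<cdot> i\<close>, and the strict pushout of \<open>i\<close> along \<open>g\<close>,
    taken in \<open>A\<close>, has corner \<open>E\<close> itself.\<close>
  have additive: "\<chi> D = \<chi> C + \<chi> E"
    if A: "C \<in> A" "M \<in> A" "D \<in> A" "E \<in> A"
      and i: "i \<in> cofibrations" "i \<in> hom SmCatP C M"
      and p: "p \<in> weak_equivalences" "p \<in> hom SmCatP M D"
      and g: "g \<in> hom SmCatP C Z" and h: "h \<in> hom SmCatP D E" and k: "k \<in> hom SmCatP Z E"
      and po: "pushout ?K i g (h \<cdot>\<^bsub>SmCatP\<^esub> p) k"
    for C M D E i p g h k
  proof -
    have hp: "h \<cdot>\<^bsub>SmCatP\<^esub> p \<in> hom SmCatP M E" using cmp_hom_SmCatP p h A by blast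
    have pi: "p \<cdot>\<^bsub>SmCatP\<^esub> i \<in> hom SmCatP C D" using cmp_hom_SmCatP p i A by blast
    have "(h \<cdot>\<^bsub>SmCatP\<^esub> p) \<cdot>\<^bsub>SmCatP\<^esub> i = k \<cdot>\<^bsub>SmCatP\<^esub> g"
      using po by (simp add: pushout_def comm_square_def)
    then have "comm_square SmCatP (p \<cdot>\<^bsub>SmCatP\<^esub> i) g h k"
      using cmp_assoc_SmCatP[OF i(2) p(2) h] A by (intro comm_square_homI[OF pi g h k]) simp
    moreover have "ide SmCatP E \<cdot>\<^bsub>SmCatP\<^esub> (h \<cdot>\<^bsub>SmCatP\<^esub> p) = h \<cdot>\<^bsub>SmCatP\<^esub> p"
      "ide SmCatP E \<cdot>\<^bsub>SmCatP\<^esub> k = k"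
      using ide_cmp_SmCatP hp k A Z by blast+
    moreover have "ide SmCatP E \<in> hom SmCatP (tgt SmCatP (h \<cdot>\<^bsub>SmCatP\<^esub> p)) (tgt SmCatP h)"
      "tgt SmCatP i = src SmCatP p"
      using ide_hom_SmCatP[OF A(4)] hp h i p by (simp_all add: hom_def)
    \<comment> \<open>The comparison arrow is \<open>ide SmCatP E\<close>, a weak equivalence; the
      agreement of pushouts moves the strict square from \<open>A\<close> to
      \<open>SmCatP\<close>.\<close>
    ultimately have "homotopy_pushout SmCatP cofibrations weak_equivalences (p \<cdot>\<^bsub>SmCatP\<^esub> i) g h k"
      unfolding homotopy_pushout_def using i p assms(3)[OF i(1) po] weq[OF A(4)] by blast
    then show ?thesis
      using add A Z pi g h k unfolding cofiber_additive_def by blast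
  qed

  have chaotic_zero: "\<chi> C = 0" if C: "C \<in> A" "chaotic C" for C
  proof -
    obtain t where t: "t \<in> hom SmCatP C Z" using to_zero C by blast
    \<comment> \<open>Here \<open>t\<close> is factored as the identity cofibration followed by the
      weak equivalence \<open>t\<close>. The homotopy cofiber of \<open>C \<rightarrow> Z\<close> is
      thus \<open>Z\<close>, and \<open>\<chi> Z\<close> cancels.\<close>
    have "pushout ?K (ide SmCatP C) t t (ide SmCatP Z)"
      using W.pushout_ide[of t C Z] t C Z hom by simp
    moreover have "ide SmCatP Z \<cdot>\<^bsub>SmCatP\<^esub> t = t"
      using ide_cmp_SmCatP t C Z by blast
    ultimately have "\<chi> Z = \<chi> C + \<chi> Z"
      using additive[of C C Z Z "ide SmCatP C" t t "ide SmCatP Z" "ide SmCatP Z"]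
        C Z t cof weak_equivalence_chaotic_zero ide_hom_SmCatP by simp
    then show ?thesis by simp
  qed

  have single_object_zero: "\<chi> E = 0" if E: "E \<in> A" "Ob E = {pt E}" for E
  proof -
    obtain t where t: "t \<in> hom SmCatP E Z" using to_zero E by blast
    obtain s where s: "s \<in> hom SmCatP Z E" using from_zero E by blast
    have "t \<cdot>\<^bsub>SmCatP\<^esub> s = ide SmCatP Z"
      using zero_arrow_eq(1)[OF Z(2) Z(1)] cmp_hom_SmCatP[OF s t] ide_hom_SmCatP E Z by blast
    then have "pushout ?K t t (ide SmCatP Z) (ide SmCatP Z)"
      using W.pushout_split_epi[of t E Z s] t s E Z hom by simp
    moreover have "ide SmCatP Z \<cdot>\<^bsub>SmCatP\<^esub> ide SmCatP Z = ide SmCatP Z"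
      using ide_cmp_SmCatP ide_hom_SmCatP Z by blast
    \<comment> \<open>Any functor out of a category with a single object is injective on
      objects.\<close>
    moreover have "t \<in> cofibrations"
      using t E by (auto simp: cofibrations_def hom_def SmCatP_def)
    ultimately have "\<chi> Z = \<chi> E + \<chi> Z"
      using additive[of E Z Z Z t "ide SmCatP Z" t "ide SmCatP Z" "ide SmCatP Z"]
        E Z t weq ide_hom_SmCatP by simp
    then show ?thesis by simp
  qed

  show "\<forall>C \<in> A. \<chi> C = 0"
  proof
    fix C assume C: "C \<in> A"
    obtain C' where C': "C' \<in> A" "is_chaotic_on C C'" using assms(4) C by blast
    note ch = is_chaotic_onD[OF C'(2)]
    obtain I where i: "(C, I, C') \<in> hom SmCatP C C'" and I: "\<And>X. X \<in> Ob C \<Longrightarrow> fob I X = X"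
      by (rule pointed_map_into_chaotic_exists[of C C' "\<lambda>X. X"])
        (use ch pointed_category_A[OF C] in auto)
    have icof: "(C, I, C') \<in> cofibrations"
      using i I by (auto simp: cofibrations_def hom_def inj_on_def)
    obtain t where t: "t \<in> hom SmCatP C Z" using to_zero C by blast
    have iK: "(C, I, C') \<in> hom ?K C C'" and tK: "t \<in> hom ?K C Z"
      using i t C C'(1) Z(1) hom by auto
    \<comment> \<open>The cofiber is formed inside \<open>A\<close>, so that its corner
      \<open>E\<close> lies in \<open>A\<close> and \<open>\<chi>\<close> can be applied to
      it.\<close>
    have "\<exists>h k. pushout ?K (C, I, C') t h k"
    proof (rule W.cof_pushout_ex)
      show "(C, I, C') \<in> cofibrations \<inter> Ar ?K" "t \<in> Ar ?K" "src ?K (C, I, C') = src ?K t"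
        using icof iK tK Z(1) unfolding hom_def by simp_all
    qed
    then obtain h k where po: "pushout ?K (C, I, C') t h k" by blast
    define E where "E = tgt SmCatP h"
    have "E \<in> A" and h: "h \<in> hom SmCatP C' E" and k: "k \<in> hom SmCatP Z E"
      using po t unfolding pushout_def comm_square_def hom_def E_def by simp_all
    \<comment> \<open>A second use of closure under chaotic categories: \<open>E'\<close> is the
      target of the two functors that collapse the objects of \<open>E\<close>.\<close>
    obtain E' where E': "E' \<in> A" "is_chaotic_on E E'" using assms(4) \<open>E \<in> A\<close> by blast
    have "fob (fst (snd (C, I, C'))) ` Ob C = Ob C'"
      using I ch(3) by (simp cong: image_cong_simp)
    then have "Ob E = {pt E}"
      using cofiber_single_object[OF C C'(1) Z(1) \<open>E \<in> A\<close> E'(1) Z(2) E'(2) i _ t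
          assms(3)[OF icof po] h k] by blast
    then have "\<chi> E = 0" using single_object_zero \<open>E \<in> A\<close> by blast
    moreover have "h \<cdot>\<^bsub>SmCatP\<^esub> ide SmCatP C' = h"
      using ide_cmp_SmCatP h \<open>E \<in> A\<close> C' by blast
    \<comment> \<open>The top arrow is already a cofibration, so the weak equivalence in its
      factorization is the identity of \<open>C'\<close>.\<close>
    then have "\<chi> C' = \<chi> C + \<chi> E"
      using additive[of C C' C' E "(C, I, C')" "ide SmCatP C'" t h k]
        C C' \<open>E \<in> A\<close> icof i weq ide_hom_SmCatP t h k po by simp
    ultimately show "\<chi> C = 0" using chaotic_zero C' ch by simp
  qed
qed

end
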